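(* Let $X$ be a Noetherian topological space and let $\Phi:X\longrightarrow X$ be a continuous function. Then for each $x\in X$ and for each closed subset $Y$ of $X$, the set $S:=\{n\in\mathbb{N}\colon \Phi^n(x)\in Y\}$ is a union of at most finitely many arithmetic progressions along with a set of Banach density zero.
   Context: A topological space is Noetherian if it satisfies the descending chain condition on closed subsets (there is no infinite strictly descending chain of closed subsets). $\Phi^n$ denotes the $n$-th iterate of $\Phi$. An arithmetic progression is a set $\{an+b\colon n\in\mathbb{N}\}$ with $a,b\in\mathbb{N}$; the ratio $a$ is allowed to be $0$, in which case the progression is a single point. For $S\subseteq\mathbb{N}$, the Banach density is $\delta(S):=\limsup_{|I|\to\infty}\frac{|S\cap I|}{|I|}$, where the $\limsup$ is taken over intervals $I$ of natural numbers; $S$ has Banach density zero if $\delta(S)=0$. *)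

theory Defs
  imports "HOL-Analysis.Analysis"
begin

definition noetherian_space :: "'a topology \<Rightarrow> bool" where
  "noetherian_space X \<longleftrightarrow>
     \<not> (\<exists>C :: nat \<Rightarrow> 'a set. (\<forall>n. closedin X (C n)) \<and> (\<forall>n. C (Suc n) \<subset> C n))"

(* The ratio a = 0 is allowed and gives the singleton {b}. *)
definition arithmetic_progression :: "nat set \<Rightarrow> bool" where
  "arithmetic_progression A \<longleftrightarrow> (\<exists>a b. A = {a * n + b | n. True})"

(* The filter on sets of naturals describing "I is an interval and card I tends to infinity".
   Only finite intervals are meant; the empty ones are harmless, since a property holds
   eventually iff it holds for all intervals of at least some fixed cardinality. *)
definition long_intervals :: "nat set filter" where
  "long_intervals = inf (filtercomap card at_top) (principal {I. \<exists>a b. I = {a..<b}})"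

(* Extended reals are used only because Limsup is formed in a complete lattice. *)
definition banach_density :: "nat set \<Rightarrow> ereal" where
  "banach_density S =
     Limsup long_intervals (\<lambda>I. ereal (real (card (S \<inter> I)) / real (card I)))"

end

theory Submission
  imports Defs
begin

text \<open>
  Among the closures \<open>T(a,c)\<close> of the orbit sampled along progressions \<open>{a * n + c}\<close> with \<open>a > 0\<close>, a
  minimal one exists. Fix such \<open>(a,c)\<close>. Taking a sub-progression does not shrink \<open>T(a,c)\<close>, and, by
  applying \<open>\<Phi>\<close>, the same holds for every \<open>T(a,b)\<close> with \<open>b \<ge> c\<close>. So for each such \<open>b\<close>, either the
  whole progression \<open>{a * n + b}\<close> lies in the return set \<open>S\<close>, or its intersection with \<open>S\<close> contains
  no infinite progression.

  It remains to see that a return set without infinite progressions has density zero, by Noetherian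
  induction on \<open>Y\<close>. If \<open>Y\<close> is contained in its preimage under \<open>\<Phi>\<^sup>d\<close>, then \<open>S + d \<subseteq> S\<close>, so
  \<open>S\<close> is empty or contains a progression. Otherwise
  \<open>Y \<inter> \<Phi>\<^sup>-\<^sup>d(Y)\<close> is a smaller closed set, so \<open>S \<inter> (S - d)\<close> has density zero. If this happens for all
  \<open>d\<close>, then up to density zero the elements of \<open>S\<close> are arbitrarily far apart.
\<close>

section \<open>Uniform upper density\<close>

text \<open>The finitary form of an upper bound on the Banach density: one threshold
  \<open>N\<close> serves all starting points \<open>s\<close>. The product form avoids dividing by
  the length. Density zero is handled as the validity of this bound for every positive
  \<open>\<epsilon>\<close>.\<close>

definition unif_density_le :: "real \<Rightarrow> nat set \<Rightarrow> bool" where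
  "unif_density_le \<epsilon> S \<longleftrightarrow>
     (\<exists>N. \<forall>s. \<forall>M\<ge>N. real (card (S \<inter> {s..<s+M})) \<le> \<epsilon> * real M)"

lemma unif_density_le_empty: "\<epsilon> \<ge> 0 \<Longrightarrow> unif_density_le \<epsilon> {}"
  by (simp add: unif_density_le_def)

lemma unif_density_le_subset:
  assumes "unif_density_le \<epsilon> T" "S \<subseteq> T" "\<epsilon> \<le> \<delta>"
  shows "unif_density_le \<delta> S"
proof -
  obtain N where N: "\<And>s M. M \<ge> N \<Longrightarrow> real (card (T \<inter> {s..<s+M})) \<le> \<epsilon> * real M"
    using assms(1) by (auto simp: unif_density_le_def)
  have "real (card (S \<inter> {s..<s+M})) \<le> \<delta> * real M" if "M \<ge> N" for s M
  proof -
    have "card (S \<inter> {s..<s+M}) \<le> card (T \<inter> {s..<s+M})"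
      by (intro card_mono) (use assms(2) in auto)
    moreover have "\<epsilon> * real M \<le> \<delta> * real M"
      using assms(3) by (intro mult_right_mono) auto
    ultimately show ?thesis using N[OF that, of s] by linarith
  qed
  then show ?thesis by (auto simp: unif_density_le_def)
qed

lemma unif_density_le_Un:
  assumes "unif_density_le \<epsilon> S" "unif_density_le \<delta> T"
  shows "unif_density_le (\<epsilon> + \<delta>) (S \<union> T)"
proof -
  obtain N where N: "\<And>s M. M \<ge> N \<Longrightarrow> real (card (S \<inter> {s..<s+M})) \<le> \<epsilon> * real M"
    using assms(1) by (auto simp: unif_density_le_def)
  obtain N' where N': "\<And>s M. M \<ge> N' \<Longrightarrow> real (card (T \<inter> {s..<s+M})) \<le> \<delta> * real M"
    using assms(2) by (auto simp: unif_density_le_def)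
  have "real (card ((S \<union> T) \<inter> {s..<s+M})) \<le> (\<epsilon> + \<delta>) * real M" if "M \<ge> max N N'" for s M
  proof -
    have "card ((S \<union> T) \<inter> {s..<s+M}) \<le> card (S \<inter> {s..<s+M}) + card (T \<inter> {s..<s+M})"
      unfolding Int_Un_distrib2 by (rule card_Un_le)
    then show ?thesis using N[of M s] N'[of M s] that by (simp add: algebra_simps)
  qed
  then show ?thesis unfolding unif_density_le_def by blast
qed

lemma unif_density_le_UN:
  assumes "finite I" "\<And>i \<epsilon>. i \<in> I \<Longrightarrow> \<epsilon> > 0 \<Longrightarrow> unif_density_le \<epsilon> (V i)" "\<epsilon> > 0"
  shows "unif_density_le \<epsilon> (\<Union>i\<in>I. V i)"
  using assms
proof (induction I arbitrary: \<epsilon> rule: finite_induct)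
  case empty
  then show ?case by (simp add: unif_density_le_empty)
next
  case (insert i I)
  have "unif_density_le (\<epsilon>/2 + \<epsilon>/2) (V i \<union> (\<Union>i\<in>I. V i))"
    using insert by (intro unif_density_le_Un) auto
  then show ?case by simp
qed

section \<open>Density bounds by counting in blocks\<close>

lemma card_Int_blocks_le:
  fixes S :: "nat set"
  assumes "\<And>s. card (S \<inter> {s..<s+L}) \<le> k"
  shows "card (S \<inter> {s..<s+q*L}) \<le> q * k"
proof (induction q)
  case (Suc q)
  have "S \<inter> {s..<s+Suc q*L} = (S \<inter> {s..<s+q*L}) \<union> (S \<inter> {s+q*L..<(s+q*L)+L})"
    by auto
  then have "card (S \<inter> {s..<s+Suc q*L}) \<le> card (S \<inter> {s..<s+q*L}) + card (S \<inter> {s+q*L..<(s+q*L)+L})"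
    by (metis card_Un_le)
  then show ?case using Suc assms[of "s+q*L"] by simp
qed simp

text \<open>An interval of length \<open>M \<ge> L\<close> is covered by \<open>q + 1\<close> blocks
  of length \<open>L\<close>, where \<open>q = M div L\<close>. As \<open>q \<ge> 1\<close>, this is
  at most \<open>2 * q\<close> blocks, so the factor 2 pays for the incomplete last block.\<close>

lemma unif_density_le_blocks:
  assumes "\<And>s. card (S \<inter> {s..<s+L}) \<le> k" "L > 0"
  shows "unif_density_le (2 * real k / real L) S"
proof -
  have "real (card (S \<inter> {s..<s+M})) \<le> 2 * real k / real L * real M" if "M \<ge> L" for s M
  proof -
    define q where "q = M div L"
    have q: "M \<le> Suc q * L" "q * L \<le> M" "q \<ge> 1"
      using assms(2) that dividend_less_div_times[of L M]
      by (auto simp: q_def div_greater_zero_iff Suc_le_eq)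
    have "card (S \<inter> {s..<s+M}) \<le> card (S \<inter> {s..<s+Suc q*L})"
      using q by (intro card_mono) auto
    also have "\<dots> \<le> Suc q * k" by (rule card_Int_blocks_le[OF assms(1)])
    also have "\<dots> \<le> (2 * q) * k" using q by (intro mult_right_mono) auto
    finally have "card (S \<inter> {s..<s+M}) * L \<le> (2 * q) * k * L" by (rule mult_right_mono) simp
    also have "\<dots> = 2 * k * (q * L)" by simp
    also have "\<dots> \<le> 2 * k * M" using q by (intro mult_left_mono) auto
    finally have "real (card (S \<inter> {s..<s+M}) * L) \<le> real (2 * k * M)" by (rule of_nat_mono)
    then show ?thesis using assms(2) by (simp add: field_simps)
  qed
  then show ?thesis by (auto simp: unif_density_le_def)
qed

text \<open>Two elements of \<open>S\<close> in the same residue class modulo \<open>a\<close> are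
  at least \<open>D * a\<close> apart. A window of length \<open>D * a\<close> thus meets each class
  at most once and contains at most \<open>a\<close> elements of \<open>S\<close>.\<close>

lemma unif_density_le_spread:
  assumes "a > 0" "D > 0"
    and spread: "\<And>n i. n \<in> S \<Longrightarrow> i \<in> {1..<D} \<Longrightarrow> n + i * a \<notin> S"
  shows "unif_density_le (2 / real D) S"
proof -
  have "card (S \<inter> {s..<s+D*a}) \<le> a" for s
  proof -
    have *: False
      if "n \<in> S \<inter> {s..<s+D*a}" "m \<in> S \<inter> {s..<s+D*a}" "n mod a = m mod a" "n < m" for n m
    proof -
      have "a dvd m - n" using that by (metis less_imp_le mod_eq_dvd_iff_nat)
      then obtain i where i: "m - n = i * a" by (metis dvd_def mult.commute)
      then have m: "m = n + i * a" using that by simp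
      have "s \<le> n" "m < s + D * a" using that by auto
      then have "i * a < D * a" using m by linarith
      then have "i < D" by (simp only: mult_less_cancel2)
      moreover have "i \<ge> 1" using m that by (cases i) auto
      ultimately show False using spread[of n i] that m by auto
    qed
    have "inj_on (\<lambda>n. n mod a) (S \<inter> {s..<s+D*a})"
      by (rule inj_onI) (use * in \<open>metis linorder_neqE_nat\<close>)
    then have "card (S \<inter> {s..<s+D*a}) \<le> card {..<a}"
      by (rule card_inj_on_le) (use assms(1) in auto)
    then show ?thesis by simp
  qed
  then have "unif_density_le (2 * real a / real (D * a)) S"
    using assms by (intro unif_density_le_blocks) auto
  then show ?thesis using assms by simp
qed

text \<open>The elements of \<open>S\<close> with another element of \<open>S\<close> fewer than
  \<open>D\<close> steps of length \<open>a\<close> later form a finite union of sets of density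
  zero. The remaining elements are spread out, and a large \<open>D\<close> makes their density
  small.\<close>

lemma unif_density_zero_recurrence:
  assumes "a > 0"
    and zero: "\<And>i \<epsilon>. i \<ge> 1 \<Longrightarrow> \<epsilon> > 0 \<Longrightarrow> unif_density_le \<epsilon> {n \<in> S. n + i * a \<in> S}"
    and "\<epsilon> > 0"
  shows "unif_density_le \<epsilon> S"
proof -
  obtain D :: nat where D: "D > 4 / \<epsilon>" using reals_Archimedean2 by blast
  moreover have "4 / \<epsilon> > 0" using assms by simp
  ultimately have D0: "D > 0" by linarith
  define V where "V = (\<Union>i\<in>{1..<D}. {n \<in> S. n + i * a \<in> S})"
  have "unif_density_le (\<epsilon>/2) V"
    unfolding V_def using assms by (intro unif_density_le_UN) auto
  moreover have "unif_density_le (2 / real D) (S - V)"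
    by (rule unif_density_le_spread[OF assms(1) D0]) (auto simp: V_def)
  moreover have "2 / real D \<le> \<epsilon>/2" using D D0 assms(3) by (simp add: field_simps)
  ultimately have "unif_density_le (\<epsilon>/2 + \<epsilon>/2) (V \<union> (S - V))"
    by (blast intro: unif_density_le_Un unif_density_le_subset)
  then show ?thesis by (rule unif_density_le_subset) auto
qed

section \<open>From uniform bounds to the Banach density\<close>

lemma eventually_long_intervals:
  "eventually P long_intervals \<longleftrightarrow> (\<exists>N. \<forall>s. \<forall>M\<ge>N. P {s..<s+M})"
proof -
  have "eventually P long_intervals \<longleftrightarrow>
      (\<exists>N. \<forall>I. card I \<ge> N \<longrightarrow> (\<exists>a b. I = {a..<b}) \<longrightarrow> P I)"
    by (simp add: long_intervals_def eventually_inf_principal eventually_filtercomap_at_top_linorder)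
  also have "\<dots> \<longleftrightarrow> (\<exists>N. \<forall>s. \<forall>M\<ge>N. P {s..<s+M})"
  proof
    assume "\<exists>N. \<forall>I. card I \<ge> N \<longrightarrow> (\<exists>a b. I = {a..<b}) \<longrightarrow> P I"
    then obtain N where "\<And>I. card I \<ge> N \<Longrightarrow> (\<exists>a b. I = {a..<b}) \<Longrightarrow> P I" by blast
    then have "P {s..<s+M}" if "M \<ge> N" for s M using that by (metis add_diff_cancel_left' card_atLeastLessThan)
    then show "\<exists>N. \<forall>s. \<forall>M\<ge>N. P {s..<s+M}" by blast
  next
    assume "\<exists>N. \<forall>s. \<forall>M\<ge>N. P {s..<s+M}"
    then obtain N where N: "\<And>s M. M \<ge> N \<Longrightarrow> P {s..<s+M}" by blast
    \<comment> \<open>The bound \<open>Suc N\<close> forces \<open>a < b\<close>, so truncated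
      subtraction gives \<open>a + (b - a) = b\<close>.\<close>
    have "P {a..<b}" if "card {a..<b} \<ge> Suc N" for a b
      using N[of "b - a" a] that by simp
    then show "\<exists>N. \<forall>I. card I \<ge> N \<longrightarrow> (\<exists>a b. I = {a..<b}) \<longrightarrow> P I" by blast
  qed
  finally show ?thesis .
qed

lemma banach_density_eq_0:
  assumes "\<And>\<epsilon>. \<epsilon> > 0 \<Longrightarrow> unif_density_le \<epsilon> S"
  shows "banach_density S = 0"
proof (rule antisym)
  show "banach_density S \<le> 0"
  proof (rule ereal_le_epsilon2)
    fix \<epsilon> :: real assume "\<epsilon> > 0"
    then obtain N where N: "\<And>s M. M \<ge> N \<Longrightarrow> real (card (S \<inter> {s..<s+M})) \<le> \<epsilon> * real M"
      using assms[of \<epsilon>] by (auto simp: unif_density_le_def)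
    have "real (card (S \<inter> {s..<s+M})) / real (card {s..<s+M}) \<le> \<epsilon>" if "M \<ge> Suc N" for s M
      using N[of M s] that by (simp add: divide_le_eq)
    then have "\<forall>\<^sub>F I in long_intervals. ereal (real (card (S \<inter> I)) / real (card I)) \<le> ereal \<epsilon>"
      unfolding eventually_long_intervals ereal_less_eq by blast
    then show "banach_density S \<le> 0 + ereal \<epsilon>"
      unfolding banach_density_def by (simp add: Limsup_bounded)
  qed
  \<comment> \<open>The lower bound for \<open>Limsup\<close> requires a proper filter.\<close>
  have "long_intervals \<noteq> bot"
    by (auto simp: trivial_limit_def eventually_long_intervals)
  then show "0 \<le> banach_density S"
    unfolding banach_density_def by (intro le_Limsup) auto
qed

section \<open>Return sets\<close>

lemma noetherian_space_wf:
  assumes "noetherian_space X"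
  shows "wf {(A, B). closedin X A \<and> closedin X B \<and> A \<subset> B}"
  using assms by (simp add: wf_iff_no_infinite_down_chain noetherian_space_def) metis

lemma continuous_map_funpow:
  "continuous_map X X f \<Longrightarrow> continuous_map X X (f ^^ n)"
  by (induction n) (auto intro: continuous_map_compose simp: id_def[symmetric])

lemma closure_of_image_closure_of:
  assumes "continuous_map X Z f"
  shows "Z closure_of (f ` (X closure_of S)) = Z closure_of (f ` (topspace X \<inter> S))"
proof
  have "f ` (X closure_of S) \<subseteq> Z closure_of (f ` (topspace X \<inter> S))"
    using assms by (metis closure_of_restrict continuous_map_image_closure_subset)
  then show "Z closure_of (f ` (X closure_of S)) \<subseteq> Z closure_of (f ` (topspace X \<inter> S))"
    by (simp add: closure_of_minimal)
  have "topspace X \<inter> S \<subseteq> X closure_of S" by (rule closure_of_subset_Int)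
  then show "Z closure_of (f ` (topspace X \<inter> S)) \<subseteq> Z closure_of (f ` (X closure_of S))"
    by (intro closure_of_mono image_mono)
qed

text \<open>The set \<open>R\<close> restricts the times to those residue classes that contain no
  infinite progression of return times. It is only stable under adding \<open>a\<close>, so all
  shifts in the induction are multiples of \<open>a\<close>.\<close>

lemma return_set_density_zero:
  assumes noeth: "noetherian_space X"
    and cont: "continuous_map X X \<Phi>" and x: "x \<in> topspace X"
    and "a > 0" and R: "\<And>n. n \<in> R \<Longrightarrow> n + a \<in> R"
    and "closedin X Y"
    and "\<And>p q. p > 0 \<Longrightarrow> \<not> {p * n + q | n. True} \<subseteq> {n \<in> R. (\<Phi> ^^ n) x \<in> Y}"
    and "\<epsilon> > 0"
  shows "unif_density_le \<epsilon> {n \<in> R. (\<Phi> ^^ n) x \<in> Y}"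
  using assms(6-8)
proof (induction Y arbitrary: \<epsilon> rule: wf_induct_rule[OF noetherian_space_wf[OF noeth]])
  case (1 Y)
  define U where "U = {n \<in> R. (\<Phi> ^^ n) x \<in> Y}"
  have orbit: "(\<Phi> ^^ n) x \<in> topspace X" for n
    using continuous_map_funpow[OF cont, of n] x by (auto simp: continuous_map_def)
  have Rmult: "n + i * a \<in> R" if "n \<in> R" for n i
  proof (induction i)
    case (Suc i)
    then show ?case using R[of "n + i * a"] by (simp add: add.assoc add.commute[of a])
  qed (use that in simp)
  show ?case
  proof (cases "U = {}")
    case True
    then show ?thesis using 1(4) unif_density_le_empty[of \<epsilon>] by (simp flip: U_def)
  next
    case False
    then obtain q where q: "q \<in> U" by blast
    have "unif_density_le \<epsilon> {n \<in> U. n + i * a \<in> U}" if i: "i \<ge> 1" and "\<epsilon> > 0" for i \<epsilon>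
    proof -
      \<comment> \<open>The points of \<open>Y\<close> that are in \<open>Y\<close> again after
        \<open>i * a\<close> steps; times in \<open>U\<close> with \<open>n + i * a\<close> in
        \<open>U\<close> have their orbit point in \<open>Z\<close>.\<close>
      define Z where "Z = {y \<in> topspace X. (\<Phi> ^^ (i * a)) y \<in> Y} \<inter> Y"
      have Z: "(\<Phi> ^^ n) x \<in> Z \<longleftrightarrow> (\<Phi> ^^ n) x \<in> Y \<and> (\<Phi> ^^ (n + i * a)) x \<in> Y" for n
        using orbit by (auto simp: Z_def funpow_add add.commute[of n])
      have closed: "closedin X Z"
        unfolding Z_def using 1(2) continuous_map_funpow[OF cont]
        by (intro closedin_Int closedin_continuous_map_preimage) auto
      have "Z \<noteq> Y"
      proof
        assume "Z = Y"
        \<comment> \<open>If \<open>Z = Y\<close>, every visit recurs \<open>i * a\<close> steps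
          later, so the visit at time \<open>q\<close> starts a forbidden progression.\<close>
        then have step: "n + i * a \<in> U" if "n \<in> U" for n
          using that Z[of n] Rmult[of n i] by (auto simp: U_def)
        have "i * a * n + q \<in> U" for n
        proof (induction n)
          case (Suc n)
          then show ?case using step[of "i * a * n + q"] by (simp add: algebra_simps)
        qed (use q in simp)
        then have "{i * a * n + q | n. True} \<subseteq> U" by blast
        then show False using 1(3)[of "i * a" q] i \<open>a > 0\<close> by (simp add: U_def)
      qed
      then have "Z \<subset> Y" by (auto simp: Z_def)
      then have "unif_density_le \<epsilon> {n \<in> R. (\<Phi> ^^ n) x \<in> Z}"
      proof (intro 1(1))
        fix p q :: nat assume "p > 0"
        show "\<not> {p * n + q | n. True} \<subseteq> {n \<in> R. (\<Phi> ^^ n) x \<in> Z}"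
          using 1(3)[OF \<open>p > 0\<close>, of q] \<open>Z \<subset> Y\<close> by blast
      qed (use closed 1(2) \<open>\<epsilon> > 0\<close> in auto)
      then show ?thesis
        by (rule unif_density_le_subset) (auto simp: U_def Z)
    qed
    then show ?thesis
      using unif_density_zero_recurrence[OF \<open>a > 0\<close>, of U \<epsilon>] 1(4) by (simp add: U_def)
  qed
qed

section \<open>Closures of orbits along progressions\<close>

definition orbit_closure :: "'a topology \<Rightarrow> ('a \<Rightarrow> 'a) \<Rightarrow> 'a \<Rightarrow> nat \<Rightarrow> nat \<Rightarrow> 'a set" where
  "orbit_closure X \<Phi> x a c = X closure_of (range (\<lambda>n. (\<Phi> ^^ (a * n + c)) x))"

lemma orbit_closure_subprogression:
  "orbit_closure X \<Phi> x (a * k) (c + j * a) \<subseteq> orbit_closure X \<Phi> x a c"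
proof -
  have "(\<Phi> ^^ (a * k * n + (c + j * a))) x = (\<Phi> ^^ (a * (k * n + j) + c)) x" for n
    by (simp add: algebra_simps)
  then show ?thesis
    unfolding orbit_closure_def by (intro closure_of_mono) auto
qed

lemma orbit_closure_shift:
  assumes "continuous_map X X \<Phi>" "x \<in> topspace X"
  shows "orbit_closure X \<Phi> x a (c + i) = X closure_of ((\<Phi> ^^ i) ` orbit_closure X \<Phi> x a c)"
proof -
  let ?O = "range (\<lambda>n. (\<Phi> ^^ (a * n + c)) x)"
  have "?O \<subseteq> topspace X"
    using continuous_map_funpow[OF assms(1)] assms(2) by (auto simp: continuous_map_def)
  moreover have "range (\<lambda>n. (\<Phi> ^^ (a * n + (c + i))) x) = (\<Phi> ^^ i) ` ?O"
  proof -
    have "(\<Phi> ^^ (a * n + (c + i))) x = (\<Phi> ^^ i) ((\<Phi> ^^ (a * n + c)) x)" for n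
      by (metis add.assoc add.commute comp_apply funpow_add)
    then show ?thesis by (simp add: image_image)
  qed
  ultimately show ?thesis
    unfolding orbit_closure_def closure_of_image_closure_of[OF continuous_map_funpow[OF assms(1)]]
    by (simp add: Int_absorb1)
qed

text \<open>Whether a progression consists of return times depends only on its orbit closure, so
  progressions with equal closures behave alike.\<close>

lemma orbit_closure_subset_iff:
  assumes "continuous_map X X \<Phi>" "x \<in> topspace X" "closedin X Y"
  shows "orbit_closure X \<Phi> x a c \<subseteq> Y \<longleftrightarrow> {a * n + c | n. True} \<subseteq> {n. (\<Phi> ^^ n) x \<in> Y}"
proof -
  let ?O = "range (\<lambda>n. (\<Phi> ^^ (a * n + c)) x)"
  have "?O \<subseteq> topspace X"
    using continuous_map_funpow[OF assms(1)] assms(2) by (auto simp: continuous_map_def)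
  then have "orbit_closure X \<Phi> x a c \<subseteq> Y \<longleftrightarrow> ?O \<subseteq> Y"
    unfolding orbit_closure_def
    by (meson assms(3) closure_of_minimal closure_of_subset order_trans)
  then show ?thesis by auto
qed

lemma orbit_closure_stable:
  assumes "noetherian_space X" "continuous_map X X \<Phi>" "x \<in> topspace X"
  obtains a c where "a > 0"
    and "\<And>k j b. k > 0 \<Longrightarrow> b \<ge> c \<Longrightarrow>
      orbit_closure X \<Phi> x (a * k) (b + j * a) = orbit_closure X \<Phi> x a b"
proof -
  define F where "F = {orbit_closure X \<Phi> x a c | a c. a > 0}"
  have "orbit_closure X \<Phi> x 1 0 \<in> F" by (auto simp: F_def)
  then obtain Z where Z: "Z \<in> F"
    and min: "\<And>W. (W, Z) \<in> {(A, B). closedin X A \<and> closedin X B \<and> A \<subset> B} \<Longrightarrow> W \<notin> F"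
    by (rule wfE_min[OF noetherian_space_wf[OF assms(1)]]) blast
  obtain a c where ac: "a > 0" "Z = orbit_closure X \<Phi> x a c" using Z by (auto simp: F_def)
  have closed: "closedin X (orbit_closure X \<Phi> x p q)" for p q
    by (simp add: orbit_closure_def)
  have base: "orbit_closure X \<Phi> x (a * k) (c + j * a) = Z" if "k > 0" for k j
  proof -
    have "orbit_closure X \<Phi> x (a * k) (c + j * a) \<in> F"
    proof -
      have "a * k > 0" using that ac(1) by simp
      then show ?thesis unfolding F_def by blast
    qed
    moreover have "orbit_closure X \<Phi> x (a * k) (c + j * a) \<subseteq> Z"
      unfolding ac by (rule orbit_closure_subprogression)
    ultimately show ?thesis using min closed ac by blast
  qed
  show thesis
  proof (rule that[OF ac(1)])
    fix k j b :: nat assume "k > 0" "b \<ge> c"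
    then obtain i where b: "b = c + i" using le_Suc_ex by blast
    \<comment> \<open>Minimality settles only the offsets \<open>c + j * a\<close>. For
      \<open>b = c + i\<close>, both closures are closures of the image under
      \<open>\<Phi> ^^ i\<close> of sets already known to be equal.\<close>
    have "orbit_closure X \<Phi> x (a * k) (b + j * a) = orbit_closure X \<Phi> x (a * k) ((c + j * a) + i)"
      by (simp add: b algebra_simps)
    also have "\<dots> = X closure_of ((\<Phi> ^^ i) ` orbit_closure X \<Phi> x (a * k) (c + j * a))"
      by (rule orbit_closure_shift[OF assms(2,3)])
    also have "\<dots> = X closure_of ((\<Phi> ^^ i) ` orbit_closure X \<Phi> x a c)"
      by (simp only: base[OF \<open>k > 0\<close>] ac(2))
    also have "\<dots> = orbit_closure X \<Phi> x a b"
      unfolding b by (rule orbit_closure_shift[OF assms(2,3), symmetric])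
    finally show "orbit_closure X \<Phi> x (a * k) (b + j * a) = orbit_closure X \<Phi> x a b" .
  qed
qed

section \<open>Decomposition of the return set by residue classes\<close>

theorem theorem1p4:
  fixes X :: "'a topology" and \<Phi> :: "'a \<Rightarrow> 'a" and x :: 'a and Y :: "'a set"
  assumes "noetherian_space X"
    and "continuous_map X X \<Phi>"
    and "x \<in> topspace X"
    and "closedin X Y"
  shows "\<exists>\<A> B. finite \<A> \<and> (\<forall>A\<in>\<A>. arithmetic_progression A) \<and> banach_density B = 0 \<and>
           {n :: nat. (\<Phi> ^^ n) x \<in> Y} = \<Union>\<A> \<union> B"
proof -
  define S where "S = {n. (\<Phi> ^^ n) x \<in> Y}"
  define AP where "AP = (\<lambda>a b. {a * n + b | n :: nat. True})"
  obtain a c where a: "a > 0" and stable: "\<And>k j b. k > 0 \<Longrightarrow> b \<ge> c \<Longrightarrow>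
      orbit_closure X \<Phi> x (a * k) (b + j * a) = orbit_closure X \<Phi> x a b"
    using orbit_closure_stable[OF assms(1-3)] by metis
  have AP_iff: "AP (a * k) (b + j * a) \<subseteq> S \<longleftrightarrow> AP a b \<subseteq> S" if "k > 0" "b \<ge> c" for k j b
    using stable[OF that, of j] orbit_closure_subset_iff[OF assms(2-4)]
    unfolding AP_def S_def by metis
  define R where "R = {n. n \<ge> c \<and> \<not> AP a n \<subseteq> S}"
  have R: "n + a \<in> R" if "n \<in> R" for n
    using AP_iff[of 1 n 1] that by (simp add: R_def)
  \<comment> \<open>A progression of ratio \<open>p\<close> from \<open>q\<close> contains the one
    of ratio \<open>a * p\<close>. By \<open>AP_iff\<close> with \<open>j = 0\<close>, the whole of
    \<open>AP a q\<close> would then lie in \<open>S\<close>, against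
    \<open>q \<in> R\<close>.\<close>
  have no_AP: "\<not> AP p q \<subseteq> {n \<in> R. (\<Phi> ^^ n) x \<in> Y}" if "p > 0" for p q
  proof
    assume sub: "AP p q \<subseteq> {n \<in> R. (\<Phi> ^^ n) x \<in> Y}"
    have "AP (a * p) q \<subseteq> AP p q" unfolding AP_def by (auto intro: exI[of _ "a * _"])
    then have "AP (a * p) q \<subseteq> S" using sub by (auto simp: S_def)
    moreover have "q \<in> AP p q" by (auto simp: AP_def)
    then have "q \<in> R" using sub by blast
    ultimately show False using AP_iff[of p q 0] that by (simp add: R_def)
  qed
  define B where "B = {n \<in> R. (\<Phi> ^^ n) x \<in> Y}"
  have B: "banach_density B = 0"
    unfolding B_def using no_AP
    by (intro banach_density_eq_0 return_set_density_zero[OF assms(1-3) a R assms(4)])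
      (auto simp: AP_def)
  \<comment> \<open>Each good residue class modulo \<open>a\<close> is represented by its element of
    \<open>{c..<c+a}\<close>. The finitely many return times before \<open>c\<close>, where
    stability is not known, become singletons of ratio 0.\<close>
  define \<A> where "\<A> = AP a ` {b \<in> {c..<c+a}. AP a b \<subseteq> S} \<union> AP 0 ` {n \<in> S. n < c}"
  have "finite \<A>" by (simp add: \<A>_def)
  moreover have "\<forall>A\<in>\<A>. arithmetic_progression A"
    unfolding \<A>_def arithmetic_progression_def AP_def by blast
  moreover have "S = \<Union>\<A> \<union> B"
  proof (intro equalityI subsetI)
    fix n assume n: "n \<in> S"
    consider "n < c" | "n \<ge> c" "\<not> AP a n \<subseteq> S" | "n \<ge> c" "AP a n \<subseteq> S" by linarith
    then show "n \<in> \<Union>\<A> \<union> B"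
    proof cases
      case 1
      then have "AP 0 n \<in> \<A>" "n \<in> AP 0 n" using n by (auto simp: \<A>_def AP_def)
      then show ?thesis by blast
    next
      case 2
      then show ?thesis using n by (simp add: B_def R_def S_def)
    next
      case 3
      define b where "b = c + (n - c) mod a"
      define j where "j = (n - c) div a"
      have nb: "n = b + j * a"
        using 3(1) by (simp add: b_def j_def)
      have b: "b \<in> {c..<c+a}" using a by (simp add: b_def)
      \<comment> \<open>Here \<open>AP_iff\<close> is used backwards: the tail \<open>AP a n\<close>
        of \<open>AP a b\<close> lies in \<open>S\<close>, hence so does all of
        \<open>AP a b\<close>.\<close>
      then have "AP a b \<subseteq> S" using 3(2) AP_iff[of 1 b j] by (simp add: nb)
      then have "AP a b \<in> \<A>" using b by (auto simp: \<A>_def)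
      moreover have "n = a * j + b" using nb by (simp add: mult.commute)
      then have "n \<in> AP a b" unfolding AP_def by blast
      ultimately show ?thesis by blast
    qed
  next
    fix n assume "n \<in> \<Union>\<A> \<union> B"
    then show "n \<in> S" by (auto simp: \<A>_def B_def S_def AP_def)
  qed
  ultimately show ?thesis using B unfolding S_def by blast
qed

end
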